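(* Let $H$ be a group and let $A_i,B_i,C_i\subseteq H$ ($1\le i\le n$) be $n$ triples of subsets satisfying the simultaneous triple product property. Then the following subsets $H_1,H_2,H_3$ of $G=\mathrm{Sym}_n\ltimes H^n$ satisfy the triple product property: $$H_1=\{h\pi:\pi\in\mathrm{Sym}_n,\ h\in H^n,\ h_i\in A_i\text{ for each }i\},$$ $$H_2=\{h\pi:\pi\in\mathrm{Sym}_n,\ h\in H^n,\ h_i\in B_i\text{ for each }i\},$$ $$H_3=\{h\pi:\pi\in\mathrm{Sym}_n,\ h\in H^n,\ h_i\in C_i\text{ for each }i\}.$$
   Context: For a subset $S$ of a group, $Q(S)=\{s_1s_2^{-1}:s_1,s_2\in S\}$. Subsets $S_1,S_2,S_3$ satisfy the triple product property if $q_i\in Q(S_i)$ and $q_1q_2q_3=1$ imply $q_1=q_2=q_3=1$. Triples of subsets $A_i,B_i,C_i$ ($1\le i\le n$) of a group $H$ satisfy the simultaneous triple product property if (i) for each $i$, $A_i,B_i,C_i$ satisfy the triple product property, and (ii) for all $i,j,k$, $a_i(a_j')^{-1}b_j(b_k')^{-1}c_k(c_i')^{-1}=1$ with $a_i\in A_i$, $a_j'\in A_j$, $b_j\in B_j$, $b_k'\in B_k$, $c_k\in C_k$, $c_i'\in C_i$ implies $i=j=k$. $\mathrm{Sym}_n$ is the symmetric group on $\{1,\dots,n\}$; it acts on $H^n$ from the right by $(h^\pi)_i=h_{\pi(i)}$. The semidirect product $\mathrm{Sym}_n\ltimes H^n$ is the set $\mathrm{Sym}_n\times H^n$ with multiplication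 $(\pi_1,h_1)(\pi_2,h_2)=(\pi_1\pi_2,\,h_1^{\pi_2}h_2)$; $\mathrm{Sym}_n$ and $H^n$ are identified with the corresponding subgroups, and $h\pi$ denotes the product in $G$ of $h\in H^n$ and $\pi\in\mathrm{Sym}_n$. *)

theory Defs
  imports "HOL-Algebra.Algebra"
begin

definition right_quotient_set :: "('a, 'b) monoid_scheme \<Rightarrow> 'a set \<Rightarrow> 'a set"  (\<open>Q\<index>\<close>)
  where "Q\<^bsub>G\<^esub> S = {s1 \<otimes>\<^bsub>G\<^esub> inv\<^bsub>G\<^esub> s2 | s1 s2. s1 \<in> S \<and> s2 \<in> S}"

definition triple_product_property ::
    "('a, 'b) monoid_scheme \<Rightarrow> 'a set \<Rightarrow> 'a set \<Rightarrow> 'a set \<Rightarrow> bool"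
  where "triple_product_property G S1 S2 S3 \<longleftrightarrow>
    S1 \<subseteq> carrier G \<and> S2 \<subseteq> carrier G \<and> S3 \<subseteq> carrier G \<and>
    (\<forall>q1 \<in> Q\<^bsub>G\<^esub> S1. \<forall>q2 \<in> Q\<^bsub>G\<^esub> S2. \<forall>q3 \<in> Q\<^bsub>G\<^esub> S3.
      q1 \<otimes>\<^bsub>G\<^esub> q2 \<otimes>\<^bsub>G\<^esub> q3 = \<one>\<^bsub>G\<^esub> \<longrightarrow> q1 = \<one>\<^bsub>G\<^esub> \<and> q2 = \<one>\<^bsub>G\<^esub> \<and> q3 = \<one>\<^bsub>G\<^esub>)"

definition simultaneous_triple_product_property ::
    "('a, 'b) monoid_scheme \<Rightarrow> nat \<Rightarrow> (nat \<Rightarrow> 'a set) \<Rightarrow> (nat \<Rightarrow> 'a set) \<Rightarrow> (nat \<Rightarrow> 'a set) \<Rightarrow> bool"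
  where "simultaneous_triple_product_property H n A B C \<longleftrightarrow>
    (\<forall>i \<in> {1..n}. triple_product_property H (A i) (B i) (C i)) \<and>
    (\<forall>i \<in> {1..n}. \<forall>j \<in> {1..n}. \<forall>k \<in> {1..n}.
      \<forall>a \<in> A i. \<forall>a' \<in> A j. \<forall>b \<in> B j. \<forall>b' \<in> B k. \<forall>c \<in> C k. \<forall>c' \<in> C i.
        a \<otimes>\<^bsub>H\<^esub> inv\<^bsub>H\<^esub> a' \<otimes>\<^bsub>H\<^esub> b \<otimes>\<^bsub>H\<^esub> inv\<^bsub>H\<^esub> b' \<otimes>\<^bsub>H\<^esub> c \<otimes>\<^bsub>H\<^esub> inv\<^bsub>H\<^esub> c' = \<one>\<^bsub>H\<^esub> \<longrightarrow> i = j \<and> j = k)"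

abbreviation power_group :: "nat \<Rightarrow> ('a, 'b) monoid_scheme \<Rightarrow> (nat \<Rightarrow> 'a) monoid"
  where "power_group n H \<equiv> product_group {1..n} (\<lambda>_. H)"

text \<open>Elements of \<open>H\<^sup>n\<close> are extensional functions, hence the restriction. This is a right action
  because the product in \<^const>\<open>sym_group\<close> is \<open>\<pi> \<circ> \<sigma>\<close>, i.e. \<open>\<sigma>\<close> is applied first.\<close>

definition sym_act :: "nat \<Rightarrow> (nat \<Rightarrow> 'a) \<Rightarrow> (nat \<Rightarrow> nat) \<Rightarrow> nat \<Rightarrow> 'a"
  where "sym_act n h \<pi> = (\<lambda>i\<in>{1..n}. h (\<pi> i))"

definition sym_semidirect ::
    "nat \<Rightarrow> ('a, 'b) monoid_scheme \<Rightarrow> ((nat \<Rightarrow> nat) \<times> (nat \<Rightarrow> 'a)) monoid"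
  where "sym_semidirect n H =
    \<lparr> carrier = carrier (sym_group n) \<times> carrier (power_group n H),
      monoid.mult = (\<lambda>(\<pi>1, h1) (\<pi>2, h2).
        (\<pi>1 \<otimes>\<^bsub>sym_group n\<^esub> \<pi>2, sym_act n h1 \<pi>2 \<otimes>\<^bsub>power_group n H\<^esub> h2)),
      one = (\<one>\<^bsub>sym_group n\<^esub>, \<one>\<^bsub>power_group n H\<^esub>) \<rparr>"

definition embed_sym ::
    "nat \<Rightarrow> ('a, 'b) monoid_scheme \<Rightarrow> (nat \<Rightarrow> nat) \<Rightarrow> (nat \<Rightarrow> nat) \<times> (nat \<Rightarrow> 'a)"
  where "embed_sym n H \<pi> = (\<pi>, \<one>\<^bsub>power_group n H\<^esub>)"

definition embed_power :: "nat \<Rightarrow> (nat \<Rightarrow> 'a) \<Rightarrow> (nat \<Rightarrow> nat) \<times> (nat \<Rightarrow> 'a)"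
  where "embed_power n h = (\<one>\<^bsub>sym_group n\<^esub>, h)"

text \<open>The set of all \<open>h\<pi>\<close> with \<open>h\<^sub>i \<in> S\<^sub>i\<close> for each \<open>i\<close>; the product is taken in the semidirect
  product, so \<open>h\<pi>\<close> is the pair \<open>(\<pi>, h\<^sup>\<pi>)\<close> and not \<open>(\<pi>, h)\<close>.\<close>

definition sym_lift ::
    "nat \<Rightarrow> ('a, 'b) monoid_scheme \<Rightarrow> (nat \<Rightarrow> 'a set) \<Rightarrow> ((nat \<Rightarrow> nat) \<times> (nat \<Rightarrow> 'a)) set"
  where "sym_lift n H S =
    {embed_power n h \<otimes>\<^bsub>sym_semidirect n H\<^esub> embed_sym n H \<pi> | h \<pi>.
      \<pi> \<in> carrier (sym_group n) \<and> h \<in> carrier (power_group n H) \<and> (\<forall>i \<in> {1..n}. h i \<in> S i)}"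

lemma sym_act_closed:
  assumes "h \<in> carrier (power_group n H)" "\<pi> \<in> carrier (sym_group n)"
  shows "sym_act n h \<pi> \<in> carrier (power_group n H)"
proof -
  have "\<pi> i \<in> {1..n}" if "i \<in> {1..n}" for i
    using assms(2) that by (simp only: sym_group_carrier permutes_in_image)
  then show ?thesis
    using assms(1) unfolding sym_act_def by (simp add: PiE_iff)
qed

lemma sym_semidirect_is_group:
  assumes "group H"
  shows "group (sym_semidirect n H)"
proof -
  interpret H: group H by fact
  interpret S: group "sym_group n" by (rule sym_group_is_group)
  interpret P: group "power_group n H" using assms by simp
  have perm: "\<pi> i \<in> {1..n}" if "\<pi> \<in> carrier (sym_group n)" "i \<in> {1..n}" for \<pi> i
    using that by (simp only: sym_group_carrier permutes_in_image)
  have act_mult: "sym_act n (g \<otimes>\<^bsub>power_group n H\<^esub> h) \<pi> =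
      sym_act n g \<pi> \<otimes>\<^bsub>power_group n H\<^esub> sym_act n h \<pi>" if "\<pi> \<in> carrier (sym_group n)" for g h \<pi>
    using perm[OF that] unfolding sym_act_def by (auto simp: fun_eq_iff)
  have act_act: "sym_act n (sym_act n h \<pi>) \<sigma> = sym_act n h (\<pi> \<otimes>\<^bsub>sym_group n\<^esub> \<sigma>)"
    if "\<sigma> \<in> carrier (sym_group n)" for h \<pi> \<sigma>
    using perm[OF that] unfolding sym_act_def by (auto simp: fun_eq_iff sym_group_mult)
  have act_one: "sym_act n \<one>\<^bsub>power_group n H\<^esub> \<pi> = \<one>\<^bsub>power_group n H\<^esub>"
    if "\<pi> \<in> carrier (sym_group n)" for \<pi>
    using perm[OF that] unfolding sym_act_def by (auto simp: fun_eq_iff)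
  have act_id: "sym_act n h \<one>\<^bsub>sym_group n\<^esub> = h" if "h \<in> carrier (power_group n H)" for h
    using that unfolding sym_act_def sym_group_one by (auto simp: PiE_iff fun_eq_iff extensional_def)
  note [simp del] = One_nat_def mult_product_group carrier_product_group one_product_group
  show ?thesis
  proof (rule groupI)
    fix x assume x: "x \<in> carrier (sym_semidirect n H)"
    obtain \<pi> h where "x = (\<pi>, h)" by (cases x)
    have \<pi>: "\<pi> \<in> carrier (sym_group n)" and h: "h \<in> carrier (power_group n H)"
      using x \<open>x = (\<pi>, h)\<close> by (auto simp: sym_semidirect_def)
    let ?\<pi> = "inv\<^bsub>sym_group n\<^esub> \<pi>"
    let ?y = "(?\<pi>, sym_act n (inv\<^bsub>power_group n H\<^esub> h) ?\<pi>)"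
    have \<pi>': "?\<pi> \<in> carrier (sym_group n)" by (rule S.inv_closed[OF \<pi>])
    have h': "inv\<^bsub>power_group n H\<^esub> h \<in> carrier (power_group n H)" by (rule P.inv_closed[OF h])
    have "?y \<in> carrier (sym_semidirect n H)"
      using \<pi>' sym_act_closed[OF h' \<pi>'] unfolding sym_semidirect_def
      by (simp only: partial_object.simps mem_Times_iff fst_conv snd_conv)
    moreover have "sym_act n (sym_act n (inv\<^bsub>power_group n H\<^esub> h) ?\<pi>) \<pi> = inv\<^bsub>power_group n H\<^esub> h"
      by (simp only: act_act[OF \<pi>] S.l_inv[OF \<pi>] act_id[OF h'])
    then have "?y \<otimes>\<^bsub>sym_semidirect n H\<^esub> x = \<one>\<^bsub>sym_semidirect n H\<^esub>"
      unfolding sym_semidirect_def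
      by (simp only: \<open>x = (\<pi>, h)\<close> monoid.simps prod.case S.l_inv[OF \<pi>] P.l_inv[OF h])
    ultimately show "\<exists>y \<in> carrier (sym_semidirect n H).
        y \<otimes>\<^bsub>sym_semidirect n H\<^esub> x = \<one>\<^bsub>sym_semidirect n H\<^esub>" by blast
  qed (auto simp: sym_semidirect_def sym_act_closed act_mult act_act act_one act_id
        S.m_assoc P.m_assoc)
qed

lemma embed_sym_hom:
  assumes "group H"
  shows "embed_sym n H \<in> hom (sym_group n) (sym_semidirect n H)"
proof -
  interpret H: group H by fact
  show ?thesis
  proof (rule homI)
    fix \<pi> \<sigma> assume \<sigma>: "\<sigma> \<in> carrier (sym_group n)"
    have "\<sigma> i \<in> {1..n}" if "i \<in> {1..n}" for i
      using that \<sigma> by (simp only: sym_group_carrier permutes_in_image)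
    then show "embed_sym n H (\<pi> \<otimes>\<^bsub>sym_group n\<^esub> \<sigma>) =
        embed_sym n H \<pi> \<otimes>\<^bsub>sym_semidirect n H\<^esub> embed_sym n H \<sigma>"
      by (auto simp: embed_sym_def sym_semidirect_def sym_act_def fun_eq_iff)
  qed (auto simp: embed_sym_def sym_semidirect_def)
qed

lemma embed_power_hom:
  "embed_power n \<in> hom (power_group n H) (sym_semidirect n H)"
  by (rule homI)
    (auto simp: embed_power_def sym_semidirect_def sym_act_def sym_group_def permutes_id fun_eq_iff)

end

(* The quotient of two elements of sym_lift n H S is a pair (\<rho>, g) with
   g j = u * v^-1 for some u in S (\<rho> j) and v in S j. In a product (\<rho>1, g1) (\<rho>2, g2) (\<rho>3, g3) = 1 we have
   \<rho>1 \<rho>2 \<rho>3 = 1, so the j-th coordinate is exactly of the shape to which the simultaneous triple product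
   property applies, with indices j, \<rho>2 (\<rho>3 j) and \<rho>3 j. These therefore coincide, all three
   permutations are trivial, and the triple product property in each coordinate finishes the proof. *)
theory Submission
  imports Defs
begin

lemma sym_semidirect_carrier_iff:
  "(\<rho>, g) \<in> carrier (sym_semidirect n H) \<longleftrightarrow>
    \<rho> permutes {1..n} \<and> g \<in> ({1..n} \<rightarrow>\<^sub>E carrier H)"
  by (simp add: sym_semidirect_def sym_group_carrier)

lemma sym_semidirect_mult:
  "(\<rho>, g) \<otimes>\<^bsub>sym_semidirect n H\<^esub> (\<sigma>, h) =
    (\<rho> \<circ> \<sigma>, \<lambda>i\<in>{1..n}. g (\<sigma> i) \<otimes>\<^bsub>H\<^esub> h i)"
  by (auto simp: sym_semidirect_def sym_act_def sym_group_mult fun_eq_iff)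

lemma sym_semidirect_one:
  "\<one>\<^bsub>sym_semidirect n H\<^esub> = (id, \<lambda>i\<in>{1..n}. \<one>\<^bsub>H\<^esub>)"
  by (simp add: sym_semidirect_def sym_group_one)

text \<open>The product \<open>h\<pi>\<close> is the pair of \<open>\<pi>\<close> and
  \<open>i \<mapsto> h (\<pi> i)\<close>, so moving \<open>\<pi>\<close> to the left shifts the
  index: this is why the set at coordinate \<open>i\<close> is \<open>S (\<pi> i)\<close> and not
  \<open>S i\<close>.\<close>

lemma sym_lift_memD:
  assumes "group H" "(\<pi>, f) \<in> sym_lift n H S"
  shows "\<pi> permutes {1..n}" "f \<in> ({1..n} \<rightarrow>\<^sub>E carrier H)"
    "\<And>i. i \<in> {1..n} \<Longrightarrow> f i \<in> S (\<pi> i)"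
proof -
  interpret H: group H by fact
  obtain h where \<pi>: "\<pi> permutes {1..n}" and h: "h \<in> ({1..n} \<rightarrow>\<^sub>E carrier H)"
    and hS: "\<And>i. i \<in> {1..n} \<Longrightarrow> h i \<in> S i"
    and eq: "(\<pi>, f) = embed_power n h \<otimes>\<^bsub>sym_semidirect n H\<^esub> embed_sym n H \<pi>"
    using assms(2)
    by (auto simp: sym_lift_def sym_group_carrier embed_power_def embed_sym_def
        sym_semidirect_mult sym_group_one)
  have \<pi>_in: "\<pi> i \<in> {1..n}" if "i \<in> {1..n}" for i
    using \<pi> that by (simp only: permutes_in_image)
  \<comment> \<open>Membership in the carrier lets the unit contributed by \<open>embed_sym\<close>
    be cancelled in each coordinate.\<close>
  have "h (\<pi> i) \<in> carrier H" if "i \<in> {1..n}" for i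
    using h \<pi>_in[OF that] by (rule PiE_mem)
  with eq have f: "f = (\<lambda>i\<in>{1..n}. h (\<pi> i))"
    by (auto simp: embed_power_def embed_sym_def sym_semidirect_mult fun_eq_iff)
  show "\<pi> permutes {1..n}" by (fact \<pi>)
  show "f \<in> ({1..n} \<rightarrow>\<^sub>E carrier H)"
    unfolding f using PiE_mem[OF h \<pi>_in] by (intro restrict_PiE_iff[THEN iffD2]) blast
  show "f i \<in> S (\<pi> i)" if "i \<in> {1..n}" for i
    unfolding f using hS[OF \<pi>_in[OF that]] that by simp
qed

lemma sym_lift_subset_carrier:
  assumes "group H"
  shows "sym_lift n H S \<subseteq> carrier (sym_semidirect n H)"
  using sym_lift_memD(1,2)[OF assms] by (auto simp: sym_semidirect_carrier_iff)

text \<open>No inverse in the semidirect product is computed: for \<open>q = s t^-1\<close> the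
  equation \<open>q t = s\<close> is compared coordinatewise and solved for \<open>g\<close> in
  \<open>H\<close>. The carrier clauses are part of the conclusion because \<open>S\<close> is an
  arbitrary family of sets here.\<close>

lemma right_quotient_sym_liftE:
  assumes "group H" "q \<in> Q\<^bsub>sym_semidirect n H\<^esub> (sym_lift n H S)"
  obtains \<rho> g where "q = (\<rho>, g)" "\<rho> permutes {1..n}" "g \<in> ({1..n} \<rightarrow>\<^sub>E carrier H)"
    "\<And>j. j \<in> {1..n} \<Longrightarrow> \<exists>u \<in> S (\<rho> j). \<exists>v \<in> S j.
      u \<in> carrier H \<and> v \<in> carrier H \<and> g j = u \<otimes>\<^bsub>H\<^esub> inv\<^bsub>H\<^esub> v"
proof -
  interpret H: group H by fact
  let ?G = "sym_semidirect n H"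
  interpret G: group ?G using assms(1) by (rule sym_semidirect_is_group)
  obtain s t where s: "s \<in> sym_lift n H S" and t: "t \<in> sym_lift n H S"
    and q: "q = s \<otimes>\<^bsub>?G\<^esub> inv\<^bsub>?G\<^esub> t"
    using assms(2) by (auto simp: right_quotient_set_def)
  have sG: "s \<in> carrier ?G" and tG: "t \<in> carrier ?G"
    using s t sym_lift_subset_carrier[OF assms(1)] by blast+
  have qG: "q \<in> carrier ?G" and qt: "q \<otimes>\<^bsub>?G\<^esub> t = s"
    using sG tG q by (auto simp: G.m_assoc)
  obtain \<rho> g \<pi> f \<sigma> k where pairs: "q = (\<rho>, g)" "s = (\<pi>, f)" "t = (\<sigma>, k)"
    by (metis surj_pair)
  note sD = sym_lift_memD[OF assms(1) s[unfolded pairs]]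
    and tD = sym_lift_memD[OF assms(1) t[unfolded pairs]]
  have \<rho>: "\<rho> permutes {1..n}" and g: "g \<in> ({1..n} \<rightarrow>\<^sub>E carrier H)"
    using qG by (simp_all only: pairs sym_semidirect_carrier_iff)
  have \<pi>: "\<pi> = \<rho> \<circ> \<sigma>" and f: "f = (\<lambda>i\<in>{1..n}. g (\<sigma> i) \<otimes>\<^bsub>H\<^esub> k i)"
    using qt by (auto simp: pairs sym_semidirect_mult)
  have "\<exists>u \<in> S (\<rho> j). \<exists>v \<in> S j. u \<in> carrier H \<and> v \<in> carrier H \<and> g j = u \<otimes>\<^bsub>H\<^esub> inv\<^bsub>H\<^esub> v"
    if j: "j \<in> {1..n}" for j
  proof -
    \<comment> \<open>The equation \<open>q t = s\<close> only shows \<open>g\<close> at the points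
      \<open>\<sigma> i\<close>; surjectivity of \<open>\<sigma>\<close> on the index set reaches
      every \<open>j\<close>. Then \<open>\<pi> i = \<rho> (\<sigma> i) = \<rho> j\<close> turns
      \<open>S (\<pi> i)\<close> into \<open>S (\<rho> j)\<close>.\<close>
    obtain i where i: "i \<in> {1..n}" and ij: "\<sigma> i = j"
      using permutes_image[OF tD(1)] j by (metis imageE)
    have u: "f i \<in> S (\<rho> j)" and v: "k i \<in> S j"
      using sD(3)[OF i] tD(3)[OF i] by (simp_all add: \<pi> ij)
    have fi: "f i \<in> carrier H" and ki: "k i \<in> carrier H" and gj: "g j \<in> carrier H"
      using PiE_mem[OF sD(2) i] PiE_mem[OF tD(2) i] PiE_mem[OF g j] .
    have "f i = g j \<otimes>\<^bsub>H\<^esub> k i" using i by (simp add: f ij)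
    then have "g j = f i \<otimes>\<^bsub>H\<^esub> inv\<^bsub>H\<^esub> (k i)"
      using fi gj ki H.inv_solve_right by metis
    with u v fi ki show ?thesis by blast
  qed
  with pairs(1) \<rho> g show thesis by (rule that)
qed

theorem theorem7p1:
  fixes H :: "('a, 'b) monoid_scheme" and n :: nat and A B C :: "nat \<Rightarrow> 'a set"
  assumes "group H"
    and "simultaneous_triple_product_property H n A B C"
  shows "triple_product_property (sym_semidirect n H)
    (sym_lift n H A) (sym_lift n H B) (sym_lift n H C)"
proof -
  interpret H: group H by fact
  let ?G = "sym_semidirect n H"
  have "q1 = \<one>\<^bsub>?G\<^esub> \<and> q2 = \<one>\<^bsub>?G\<^esub> \<and> q3 = \<one>\<^bsub>?G\<^esub>"
    if q: "q1 \<in> Q\<^bsub>?G\<^esub> (sym_lift n H A)" "q2 \<in> Q\<^bsub>?G\<^esub> (sym_lift n H B)" "q3 \<in> Q\<^bsub>?G\<^esub> (sym_lift n H C)"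
      and eq1: "q1 \<otimes>\<^bsub>?G\<^esub> q2 \<otimes>\<^bsub>?G\<^esub> q3 = \<one>\<^bsub>?G\<^esub>" for q1 q2 q3
  proof -
    from right_quotient_sym_liftE[OF assms(1) q(1)] obtain \<rho>1 g1
      where q1: "q1 = (\<rho>1, g1)" "\<rho>1 permutes {1..n}" "g1 \<in> ({1..n} \<rightarrow>\<^sub>E carrier H)"
        "\<And>j. j \<in> {1..n} \<Longrightarrow> \<exists>u \<in> A (\<rho>1 j). \<exists>v \<in> A j.
          u \<in> carrier H \<and> v \<in> carrier H \<and> g1 j = u \<otimes>\<^bsub>H\<^esub> inv\<^bsub>H\<^esub> v" by blast
    from right_quotient_sym_liftE[OF assms(1) q(2)] obtain \<rho>2 g2
      where q2: "q2 = (\<rho>2, g2)" "\<rho>2 permutes {1..n}" "g2 \<in> ({1..n} \<rightarrow>\<^sub>E carrier H)"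
        "\<And>j. j \<in> {1..n} \<Longrightarrow> \<exists>u \<in> B (\<rho>2 j). \<exists>v \<in> B j.
          u \<in> carrier H \<and> v \<in> carrier H \<and> g2 j = u \<otimes>\<^bsub>H\<^esub> inv\<^bsub>H\<^esub> v" by blast
    from right_quotient_sym_liftE[OF assms(1) q(3)] obtain \<rho>3 g3
      where q3: "q3 = (\<rho>3, g3)" "\<rho>3 permutes {1..n}" "g3 \<in> ({1..n} \<rightarrow>\<^sub>E carrier H)"
        "\<And>j. j \<in> {1..n} \<Longrightarrow> \<exists>u \<in> C (\<rho>3 j). \<exists>v \<in> C j.
          u \<in> carrier H \<and> v \<in> carrier H \<and> g3 j = u \<otimes>\<^bsub>H\<^esub> inv\<^bsub>H\<^esub> v" by blast
    have in2: "\<rho>2 j \<in> {1..n}" and in3: "\<rho>3 j \<in> {1..n}" if "j \<in> {1..n}" for j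
      using q2(2) q3(2) that by (simp_all only: permutes_in_image)
    have "\<rho>1 \<circ> \<rho>2 \<circ> \<rho>3 = id"
      using eq1 by (simp add: q1(1) q2(1) q3(1) sym_semidirect_mult sym_semidirect_one)
    then have perm: "\<rho>1 (\<rho>2 (\<rho>3 j)) = j" for j by (metis comp_apply id_apply)
    \<comment> \<open>Each \<open>g\<close> is permuted by the factors to its right:
      \<open>g1\<close> by \<open>\<rho>2\<close> and \<open>\<rho>3\<close>, \<open>g2\<close> by
      \<open>\<rho>3\<close>. The product of the first two factors is a restricted function
      evaluated at \<open>\<rho>3 j\<close>, so that point has to lie in the index set as
      well.\<close>
    have coord: "g1 (\<rho>2 (\<rho>3 j)) \<otimes>\<^bsub>H\<^esub> g2 (\<rho>3 j) \<otimes>\<^bsub>H\<^esub> g3 j = \<one>\<^bsub>H\<^esub>" if "j \<in> {1..n}" for j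
    proof -
      have "snd (q1 \<otimes>\<^bsub>?G\<^esub> q2 \<otimes>\<^bsub>?G\<^esub> q3) j = snd \<one>\<^bsub>?G\<^esub> j" by (simp only: eq1)
      with that in3[OF that] show ?thesis
        by (simp only: q1(1) q2(1) q3(1) sym_semidirect_mult sym_semidirect_one snd_conv
            restrict_apply if_True)
    qed
    have fixed: "\<rho>2 (\<rho>3 j) = j \<and> \<rho>3 j = j" if j: "j \<in> {1..n}" for j
    proof -
      let ?k = "\<rho>3 j" and ?l = "\<rho>2 (\<rho>3 j)"
      have k: "?k \<in> {1..n}" and l: "?l \<in> {1..n}" using in2 in3 j by blast+
      \<comment> \<open>The left set for \<open>g1 ?l\<close> is \<open>A (\<rho>1 ?l)\<close>,
        which is \<open>A j\<close> by \<open>perm\<close>. This closes the cycle of indices from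
        \<open>j\<close> through \<open>?l\<close> and \<open>?k\<close> back to
        \<open>j\<close>.\<close>
      obtain a a' where a: "a \<in> A j" "a' \<in> A ?l" "a \<in> carrier H" "a' \<in> carrier H"
          "g1 ?l = a \<otimes>\<^bsub>H\<^esub> inv\<^bsub>H\<^esub> a'"
        using q1(4)[OF l] perm by metis
      obtain b b' where b: "b \<in> B ?l" "b' \<in> B ?k" "b \<in> carrier H" "b' \<in> carrier H"
          "g2 ?k = b \<otimes>\<^bsub>H\<^esub> inv\<^bsub>H\<^esub> b'"
        using q2(4)[OF k] by blast
      obtain c c' where c: "c \<in> C ?k" "c' \<in> C j" "c \<in> carrier H" "c' \<in> carrier H"
          "g3 j = c \<otimes>\<^bsub>H\<^esub> inv\<^bsub>H\<^esub> c'"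
        using q3(4)[OF j] by blast
      have "a \<otimes>\<^bsub>H\<^esub> inv\<^bsub>H\<^esub> a' \<otimes>\<^bsub>H\<^esub> b \<otimes>\<^bsub>H\<^esub> inv\<^bsub>H\<^esub> b' \<otimes>\<^bsub>H\<^esub> c \<otimes>\<^bsub>H\<^esub> inv\<^bsub>H\<^esub> c' = \<one>\<^bsub>H\<^esub>"
        using coord[OF j] a(3,4) b(3,4) c(3,4) by (simp add: a(5) b(5) c(5) H.m_assoc)
      then have "j = ?l \<and> ?l = ?k"
        using assms(2) j k l a(1,2) b(1,2) c(1,2)
        unfolding simultaneous_triple_product_property_def by blast
      then show ?thesis by simp
    qed
    \<comment> \<open>Inside the index set \<open>fixed\<close> applies, giving
      \<open>\<rho>2 j = \<rho>2 (\<rho>3 j) = j\<close> for the second permutation; outside it a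
      permutation of the set is the identity anyway.\<close>
    have \<rho>3: "\<rho>3 = id"
      using fixed permutes_not_in[OF q3(2)] by (metis eq_id_iff)
    moreover have \<rho>2: "\<rho>2 = id"
      using fixed permutes_not_in[OF q2(2)] by (metis eq_id_iff)
    ultimately have \<rho>1: "\<rho>1 = id"
      using perm by (simp add: fun_eq_iff)
    have one: "g1 j = \<one>\<^bsub>H\<^esub> \<and> g2 j = \<one>\<^bsub>H\<^esub> \<and> g3 j = \<one>\<^bsub>H\<^esub>" if j: "j \<in> {1..n}" for j
    proof -
      \<comment> \<open>With trivial permutations both factors of \<open>g1 j\<close> come from the
        same set \<open>A j\<close>, so it is a genuine quotient; likewise for \<open>g2 j\<close>
        and \<open>g3 j\<close>.\<close>
      have "g1 j \<in> Q\<^bsub>H\<^esub> (A j)" "g2 j \<in> Q\<^bsub>H\<^esub> (B j)" "g3 j \<in> Q\<^bsub>H\<^esub> (C j)"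
        using q1(4)[OF j] q2(4)[OF j] q3(4)[OF j]
        unfolding right_quotient_set_def \<rho>1 \<rho>2 \<rho>3 id_apply by blast+
      moreover have "g1 j \<otimes>\<^bsub>H\<^esub> g2 j \<otimes>\<^bsub>H\<^esub> g3 j = \<one>\<^bsub>H\<^esub>"
        using coord[OF j] by (simp add: \<rho>2 \<rho>3)
      moreover have "triple_product_property H (A j) (B j) (C j)"
        using assms(2) j unfolding simultaneous_triple_product_property_def by blast
      ultimately show ?thesis unfolding triple_product_property_def by blast
    qed
    \<comment> \<open>Coordinates determine an element of \<open>H^n\<close> because its functions
      are extensional, hence all equal to \<open>undefined\<close> off the index set.\<close>
    have ext: "g = (\<lambda>i\<in>{1..n}. \<one>\<^bsub>H\<^esub>)"
      if "g \<in> ({1..n} \<rightarrow>\<^sub>E carrier H)" "\<And>j. j \<in> {1..n} \<Longrightarrow> g j = \<one>\<^bsub>H\<^esub>" for g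
      using that by (intro extensionalityI[of _ "{1..n}"]) (auto simp: PiE_iff)
    have "g1 = (\<lambda>i\<in>{1..n}. \<one>\<^bsub>H\<^esub>)" "g2 = (\<lambda>i\<in>{1..n}. \<one>\<^bsub>H\<^esub>)" "g3 = (\<lambda>i\<in>{1..n}. \<one>\<^bsub>H\<^esub>)"
      using ext[OF q1(3)] ext[OF q2(3)] ext[OF q3(3)] one by blast+
    then show ?thesis
      by (simp only: q1(1) q2(1) q3(1) \<rho>1 \<rho>2 \<rho>3 sym_semidirect_one simp_thms)
  qed
  then show ?thesis
    unfolding triple_product_property_def
    using sym_lift_subset_carrier[OF assms(1)] by blast
qed

end
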